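(* Every Coxeter group $\Gamma$ admits a limit aperiodic coloring by finitely many colors, i.e. there exist a finite set $F$ and a limit aperiodic coloring $\phi:\Gamma\to F$.
   Context: A Coxeter matrix $M=(m_{ij})$ is a (finite) symmetric square matrix with $1$ on the diagonal and all other entries in $\{0\}\cup\mathbb N$ (off-diagonal entries are $0$ or $\geq 2$; $0$ plays the role usually denoted $\infty$). A Coxeter group $\Gamma$ with finite generating set $S=\{s_1,\dots,s_k\}$ is a group with presentation $\langle S\mid (s_is_j)^{m_{ij}}=1\rangle$ for a Coxeter matrix $M$, with the convention $a^0=1$. A coloring of a set $X$ by a set of colors $F$ is a map $\phi:X\to F$; $F^X$ carries the product topology with $F$ discrete. A discrete group $\Gamma$ acts on $F^\Gamma$ by $(g\phi)(x)=\phi(g^{-1}x)$. A coloring $\phi:\Gamma\to F$ is aperiodic if $g\phi\ne\phi$ for all $g\in\Gamma\setminus\{e\}$, and limit aperiodic if every $\psi$ in the closure $\overline{\Gamma\phi}\subset F^\Gamma$ of its orbit is aperiodic. *)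

theory Defs
  imports "HOL-Algebra.Group" "HOL-Analysis.Function_Topology"
begin

text \<open>A letter \<open>(x, True)\<close> stands for the generator \<open>x\<close>,
  and \<open>(x, False)\<close> for its formal inverse.\<close>

definition words :: "'s set \<Rightarrow> ('s \<times> bool) list set" where
  "words X = lists (X \<times> UNIV)"

text \<open>Two words are related iff they represent the same element of
  \<open>\<langle>X | r = 1 for r \<in> R\<rangle>\<close>.\<close>

inductive pres_eq :: "'s set \<Rightarrow> ('s \<times> bool) list set \<Rightarrow> ('s \<times> bool) list \<Rightarrow> ('s \<times> bool) list \<Rightarrow> bool"
  for X :: "'s set" and R :: "('s \<times> bool) list set"
where
  refl: "w \<in> words X \<Longrightarrow> pres_eq X R w w"
| sym: "pres_eq X R u v \<Longrightarrow> pres_eq X R v u"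
| trans: "pres_eq X R u v \<Longrightarrow> pres_eq X R v w \<Longrightarrow> pres_eq X R u w"
| cancel: "u \<in> words X \<Longrightarrow> v \<in> words X \<Longrightarrow> x \<in> X \<Longrightarrow>
    pres_eq X R (u @ [(x, b), (x, \<not> b)] @ v) (u @ v)"
| rel: "u \<in> words X \<Longrightarrow> v \<in> words X \<Longrightarrow> r \<in> R \<Longrightarrow> r \<in> words X \<Longrightarrow>
    pres_eq X R (u @ r @ v) (u @ v)"

definition pres_rel :: "'s set \<Rightarrow> ('s \<times> bool) list set \<Rightarrow> (('s \<times> bool) list \<times> ('s \<times> bool) list) set" where
  "pres_rel X R = {(u, v). pres_eq X R u v}"

definition presented_group :: "'s set \<Rightarrow> ('s \<times> bool) list set \<Rightarrow> ('s \<times> bool) list set monoid" where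
  "presented_group X R =
    \<lparr>carrier = words X // pres_rel X R,
     monoid.mult = (\<lambda>A B. \<Union>u\<in>A. \<Union>v\<in>B. pres_rel X R `` {u @ v}),
     one = pres_rel X R `` {[]}\<rparr>"

lemma pres_eq_words: "pres_eq X R u v \<Longrightarrow> u \<in> words X \<and> v \<in> words X"
  by (induction rule: pres_eq.induct) (auto simp: words_def)

lemma words_append [simp]: "u @ v \<in> words X \<longleftrightarrow> u \<in> words X \<and> v \<in> words X"
  by (auto simp: words_def)

lemma pres_eq_context:
  assumes "pres_eq X R u v" "p \<in> words X" "q \<in> words X"
  shows "pres_eq X R (p @ u @ q) (p @ v @ q)"
  using assms
proof (induction rule: pres_eq.induct)
  case (refl w) then show ?case by (auto intro: pres_eq.refl)
next
  case (sym u v) then show ?case by (auto intro: pres_eq.sym)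
next
  case (trans u v w) then show ?case by (auto intro: pres_eq.trans)
next
  case (cancel u v x b)
  then show ?case using pres_eq.cancel[of "p @ u" X "v @ q" x R b] by simp
next
  case (rel u v r)
  then show ?case using pres_eq.rel[of "p @ u" X "v @ q" r R] by simp
qed

lemma pres_eq_append:
  assumes "pres_eq X R u u'" "pres_eq X R v v'"
  shows "pres_eq X R (u @ v) (u' @ v')"
proof -
  have w: "u \<in> words X" "u' \<in> words X" "v \<in> words X" "v' \<in> words X"
    using assms pres_eq_words by blast+
  have e: "[] \<in> words X" by (simp add: words_def)
  show ?thesis
    using pres_eq_context[OF assms(1) e w(3)] pres_eq_context[OF assms(2) w(2) e]
    by (auto intro: pres_eq.trans)
qed

lemma equiv_pres_rel: "equiv (words X) (pres_rel X R)"
  by (rule equivI) (auto simp: refl_on_def sym_def trans_def pres_rel_def dest: pres_eq_words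
      intro: pres_eq.refl pres_eq.sym pres_eq.trans)

lemma pres_class_eq: "pres_eq X R u v \<Longrightarrow> pres_rel X R `` {u} = pres_rel X R `` {v}"
  by (rule equiv_class_eq[OF equiv_pres_rel]) (simp add: pres_rel_def)

lemma presented_group_mult:
  assumes "u \<in> words X" "v \<in> words X"
  shows "pres_rel X R `` {u} \<otimes>\<^bsub>presented_group X R\<^esub> pres_rel X R `` {v} = pres_rel X R `` {u @ v}"
proof -
  let ?c = "\<lambda>w. pres_rel X R `` {w}"
  have eq: "?c (u' @ v') = ?c (u @ v)" if "u' \<in> ?c u" "v' \<in> ?c v" for u' v'
    by (rule pres_class_eq, rule pres_eq_append)
      (use that in \<open>simp_all add: pres_rel_def pres_eq.sym\<close>)
  have mem: "u \<in> ?c u" "v \<in> ?c v"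
    using assms by (simp_all add: pres_rel_def pres_eq.refl)
  have "(\<Union>u'\<in>?c u. \<Union>v'\<in>?c v. ?c (u' @ v')) = (\<Union>u'\<in>?c u. \<Union>v'\<in>?c v. ?c (u @ v))"
    by (intro SUP_cong HOL.refl eq)
  also have "\<dots> = ?c (u @ v)"
    using mem by blast
  finally show ?thesis by (simp add: presented_group_def)
qed

lemma inverse_word:
  assumes "w \<in> words X"
  shows "\<exists>v \<in> words X. pres_eq X R (v @ w) []"
  using assms
proof (induction w)
  case Nil then show ?case by (intro bexI[of _ "[]"]) (auto simp: words_def intro!: pres_eq.refl)
next
  case (Cons a w)
  obtain x b where a: "a = (x, b)" by force
  have x: "x \<in> X" and w: "w \<in> words X" using Cons.prems a by (auto simp: words_def)
  then obtain v where v: "v \<in> words X" "pres_eq X R (v @ w) []" using Cons.IH by blast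
  have "pres_eq X R ((v @ [(x, \<not> b)]) @ a # w) (v @ w)"
    using pres_eq.cancel[OF v(1) w x, of R "\<not> b"] a by simp
  then have "pres_eq X R ((v @ [(x, \<not> b)]) @ a # w) []" using v(2) pres_eq.trans by metis
  moreover have "v @ [(x, \<not> b)] \<in> words X" using v x by (auto simp: words_def)
  ultimately show ?case by blast
qed

lemma group_presented_group: "group (presented_group X R)"
proof (rule groupI)
  let ?G = "presented_group X R" and ?c = "\<lambda>w. pres_rel X R `` {w}"
  have car: "carrier ?G = ?c ` words X" by (auto simp: presented_group_def quotient_def)
  have one: "\<one>\<^bsub>?G\<^esub> = ?c []" by (simp add: presented_group_def)
  have e: "[] \<in> words X" by (simp add: words_def)
  show "\<one>\<^bsub>?G\<^esub> \<in> carrier ?G" using car one e by auto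
  show "x \<otimes>\<^bsub>?G\<^esub> y \<in> carrier ?G" if "x \<in> carrier ?G" "y \<in> carrier ?G" for x y
    using that by (auto simp: car presented_group_mult)
  show "x \<otimes>\<^bsub>?G\<^esub> y \<otimes>\<^bsub>?G\<^esub> z = x \<otimes>\<^bsub>?G\<^esub> (y \<otimes>\<^bsub>?G\<^esub> z)"
    if "x \<in> carrier ?G" "y \<in> carrier ?G" "z \<in> carrier ?G" for x y z
    using that by (auto simp: car presented_group_mult)
  show "\<one>\<^bsub>?G\<^esub> \<otimes>\<^bsub>?G\<^esub> x = x" if x: "x \<in> carrier ?G" for x
    using x e by (auto simp: car one presented_group_mult)
  show "\<exists>y \<in> carrier ?G. y \<otimes>\<^bsub>?G\<^esub> x = \<one>\<^bsub>?G\<^esub>" if x: "x \<in> carrier ?G" for x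
  proof -
    obtain w where w: "w \<in> words X" "x = ?c w" using x unfolding car by blast
    obtain v where v: "v \<in> words X" "pres_eq X R (v @ w) []" using inverse_word[OF w(1)] by blast
    have "?c (v @ w) = ?c []"
      using v(2) by (rule pres_class_eq)
    then have "?c v \<otimes>\<^bsub>?G\<^esub> x = \<one>\<^bsub>?G\<^esub>" using v w by (simp add: one presented_group_mult)
    then show ?thesis using v(1) unfolding car by blast
  qed
qed

text \<open>The entries with indices below \<open>k\<close> matter; an entry \<open>0\<close> plays the role of
  \<open>\<infinity>\<close> (the corresponding relator is the empty word).\<close>

definition coxeter_matrix :: "nat \<Rightarrow> (nat \<Rightarrow> nat \<Rightarrow> nat) \<Rightarrow> bool" where
  "coxeter_matrix k M \<longleftrightarrow>
    (\<forall>i<k. \<forall>j<k. M i j = M j i) \<and>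
    (\<forall>i<k. M i i = 1) \<and>
    (\<forall>i<k. \<forall>j<k. i \<noteq> j \<longrightarrow> M i j = 0 \<or> M i j \<ge> 2)"

definition coxeter_relators :: "nat \<Rightarrow> (nat \<Rightarrow> nat \<Rightarrow> nat) \<Rightarrow> (nat \<times> bool) list set" where
  "coxeter_relators k M =
    {concat (replicate (M i j) [(i, True), (j, True)]) | i j. i < k \<and> j < k}"

definition coxeter_group :: "('a, 'b) monoid_scheme \<Rightarrow> bool" where
  "coxeter_group G \<longleftrightarrow> group G \<and>
    (\<exists>k M. coxeter_matrix k M \<and> G \<cong> presented_group {..<k} (coxeter_relators k M))"

text \<open>Colorings of \<open>G\<close> by \<open>F\<close> are the elements of \<open>carrier G \<rightarrow>\<^sub>E F\<close>;
  hence the restriction to the carrier in the action.\<close>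

definition coloring_action :: "('a, 'b) monoid_scheme \<Rightarrow> 'a \<Rightarrow> ('a \<Rightarrow> 'c) \<Rightarrow> ('a \<Rightarrow> 'c)" where
  "coloring_action G g \<phi> = (\<lambda>x\<in>carrier G. \<phi> (inv\<^bsub>G\<^esub> g \<otimes>\<^bsub>G\<^esub> x))"

definition aperiodic :: "('a, 'b) monoid_scheme \<Rightarrow> ('a \<Rightarrow> 'c) \<Rightarrow> bool" where
  "aperiodic G \<phi> \<longleftrightarrow> (\<forall>g \<in> carrier G - {\<one>\<^bsub>G\<^esub>}. coloring_action G g \<phi> \<noteq> \<phi>)"

definition coloring_space :: "('a, 'b) monoid_scheme \<Rightarrow> 'c set \<Rightarrow> ('a \<Rightarrow> 'c) topology" where
  "coloring_space G F = product_topology (\<lambda>_. discrete_topology F) (carrier G)"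

definition limit_aperiodic :: "('a, 'b) monoid_scheme \<Rightarrow> 'c set \<Rightarrow> ('a \<Rightarrow> 'c) \<Rightarrow> bool" where
  "limit_aperiodic G F \<phi> \<longleftrightarrow>
    (\<forall>\<psi> \<in> coloring_space G F closure_of ((\<lambda>g. coloring_action G g \<phi>) ` carrier G).
      aperiodic G \<psi>)"

end

theory Submission
  imports Defs "HOL-Analysis.Product_Topology"
begin

text \<open>A Coxeter group is finitely generated, hence countable, and every countable group \<open>G\<close> has a
  limit aperiodic coloring by finitely many colors.

  Say that a coloring \<open>\<phi>\<close> blocks \<open>s\<close> if some finite \<open>T\<close> has the following property: each translate
  \<open>h T\<close> contains a point \<open>h t\<close> with \<open>\<phi> (h s t) \<noteq> \<phi> (h t)\<close>. A period of a coloring in the orbit closure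
  is seen by \<open>\<phi>\<close> itself on some translate of any given finite window, so a coloring that
  blocks every \<open>s \<noteq> 1\<close> is limit aperiodic (\<open>limit_aperiodic_if_blocks\<close>). In a finite group an
  injective coloring does this.

  In an infinite group each \<open>s \<noteq> 1\<close> gets a window \<open>T s\<close> disjoint from \<open>s T s\<close>, and different \<open>s\<close>
  get windows of different sizes. The pairs \<open>(s, h)\<close> then are forbidden repetitions: \<open>\<phi>\<close> on
  \<open>h s T s\<close> must not be a copy of \<open>\<phi>\<close> on \<open>h T s\<close>. A point lies in at most \<open>2 k\<close> of the
  forbidden repetitions with window size \<open>k\<close>, while a random coloring by \<open>8\<close> colors contains a given
  one with probability only \<open>1 / 8 ^ k\<close>, so one expects to be able to avoid all of them.
  For finitely many points this follows by counting (\<open>good_growth\<close>), in the manner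
  of Rosenfeld's proofs about nonrepetitive words: each further point at least doubles the number of good
  colorings. Compactness of the space of colorings (Tychonoff) passes from finite sets to all of \<open>G\<close>
  (\<open>exists_coloring_without_repetitions\<close>).\<close>

section \<open>Counting colorings without repetitions\<close>

text \<open>Constraint \<open>i\<close> forbids that the colors on \<open>\<sigma> i ` A i\<close> copy those on \<open>A i\<close>. The degree bound
  grows only linearly in the window size, whereas each repetition costs an exponential factor in that
  size; the number of points and of constraints may be infinite.\<close>

locale repetition_system =
  fixes I :: "'i set" and A :: "'i \<Rightarrow> 'v set" and \<sigma> :: "'i \<Rightarrow> 'v \<Rightarrow> 'v"
  assumes card_ge_2: "i \<in> I \<Longrightarrow> 2 \<le> card (A i)"
    and inj: "i \<in> I \<Longrightarrow> inj_on (\<sigma> i) (A i)"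
    and disjoint: "i \<in> I \<Longrightarrow> A i \<inter> \<sigma> i ` A i = {}"
    and finite_degree: "finite {i \<in> I. card (A i) = k \<and> v \<in> A i \<union> \<sigma> i ` A i}"
    and degree_le: "card {i \<in> I. card (A i) = k \<and> v \<in> A i \<union> \<sigma> i ` A i} \<le> 2 * k"
begin

definition support :: "'i \<Rightarrow> 'v set" where
  "support i = A i \<union> \<sigma> i ` A i"

definition repeats :: "('v \<Rightarrow> nat) \<Rightarrow> 'i \<Rightarrow> bool" where
  "repeats f i \<longleftrightarrow> (\<forall>a\<in>A i. f (\<sigma> i a) = f a)"

definition good :: "'v set \<Rightarrow> ('v \<Rightarrow> nat) set" where
  "good X = {f \<in> X \<rightarrow>\<^sub>E {..<8}. \<forall>i\<in>I. support i \<subseteq> X \<longrightarrow> \<not> repeats f i}"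

lemma finite_A: "i \<in> I \<Longrightarrow> finite (A i)"
  using card_ge_2[of i] card.infinite[of "A i"] by fastforce

lemma finite_good: "finite X \<Longrightarrow> finite (good X)"
  by (rule finite_subset[of _ "X \<rightarrow>\<^sub>E {..<8}"]) (auto simp: good_def intro: finite_PiE)

lemma repeats_cong:
  assumes "\<And>x. x \<in> support i \<Longrightarrow> f x = g x"
  shows "repeats f i \<longleftrightarrow> repeats g i"
  using assms by (auto simp: repeats_def support_def)

text \<open>Goodness on \<open>X\<close> only concerns constraints supported in \<open>X\<close>, so it passes to subsets. This lets
  the induction compare \<open>good X\<close> with \<open>good Y\<close> for much smaller \<open>Y\<close>.\<close>

lemma restrict_good:
  assumes "f \<in> good X" "Y \<subseteq> X"
  shows "restrict f Y \<in> good Y"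
proof -
  have "\<not> repeats (restrict f Y) i" if "i \<in> I" "support i \<subseteq> Y" for i
  proof -
    have "repeats (restrict f Y) i \<longleftrightarrow> repeats f i"
      by (rule repeats_cong) (use that in auto)
    then show ?thesis
      using assms that by (auto simp: good_def)
  qed
  then show ?thesis
    using assms by (auto simp: good_def PiE_def Pi_def)
qed

lemma good_growth_iterate:
  assumes "finite X" "Y \<subseteq> X"
    and "\<And>U v. insert v U \<subseteq> X \<Longrightarrow> v \<notin> U \<Longrightarrow> 2 * card (good U) \<le> card (good (insert v U))"
  shows "2 ^ card (X - Y) * card (good Y) \<le> card (good X)"
proof -
  have "2 ^ card D * card (good Y) \<le> card (good (Y \<union> D))" if "finite D" "D \<subseteq> X - Y" for D
    using that
  proof (induction D rule: finite_induct)
    case (insert v D)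
    then have "2 * card (good (Y \<union> D)) \<le> card (good (insert v (Y \<union> D)))"
      using assms(2) by (intro assms(3)) auto
    then show ?case
      using insert by (auto simp: mult.assoc)
  qed simp
  from this[of "X - Y"] show ?thesis
    using assms(1,2) by (simp add: Un_absorb1)
qed

text \<open>The colorings of \<open>insert v X\<close> that can fail to be good only through constraints with \<open>v\<close> in their
  support.\<close>

definition extensions :: "'v \<Rightarrow> 'v set \<Rightarrow> ('v \<Rightarrow> nat) set" where
  "extensions v X = {f \<in> insert v X \<rightarrow>\<^sub>E {..<8}. restrict f X \<in> good X}"

lemma card_extensions:
  assumes "finite X" "v \<notin> X"
  shows "card (extensions v X) = 8 * card (good X)"
proof -
  have "bij_betw (\<lambda>(c, f). f(v := c)) ({..<8} \<times> good X) (extensions v X)"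
  proof (rule bij_betw_byWitness[where f' = "\<lambda>f. (f v, restrict f X)"])
    have r: "restrict (f(v := c)) X = f" if "f \<in> good X" for f c
    proof -
      have "f \<in> extensional X"
        using that by (auto simp: good_def PiE_def)
      then show ?thesis
        using assms(2) by (auto simp: fun_eq_iff extensional_def)
    qed
    show "\<forall>a\<in>{..<8} \<times> good X. (\<lambda>f. (f v, restrict f X)) (case a of (c, f) \<Rightarrow> f(v := c)) = a"
      using r by auto
    show "\<forall>f\<in>extensions v X. (case (f v, restrict f X) of (c, f) \<Rightarrow> f(v := c)) = f"
      by (auto simp: extensions_def fun_eq_iff PiE_def extensional_def)
    show "(\<lambda>(c, f). f(v := c)) ` ({..<8} \<times> good X) \<subseteq> extensions v X"
    proof clarify
      fix c :: nat and f assume cf: "c < 8" "f \<in> good X"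
      then have "f(v := c) \<in> insert v X \<rightarrow>\<^sub>E {..<8}"
        by (auto simp: good_def PiE_def Pi_def extensional_def)
      then show "f(v := c) \<in> extensions v X"
        using r cf by (simp add: extensions_def)
    qed
    show "(\<lambda>f. (f v, restrict f X)) ` extensions v X \<subseteq> {..<8} \<times> good X"
      by (auto simp: extensions_def)
  qed
  from bij_betw_same_card[OF this] show ?thesis
    by (simp add: card_cartesian_product)
qed

text \<open>In an extension violating \<open>i\<close>, one of the sets \<open>A i\<close>, \<open>\<sigma> i ` A i\<close> contains \<open>v\<close>, and its
  colors can be read off from the other one. Erasing it loses no information and leaves a
  good coloring of \<open>X\<close> minus \<open>card (A i) - 1\<close> points. By the growth already known below \<open>X\<close>
  there are few of these.\<close>

lemma card_repeating_extensions:
  assumes "finite X" "v \<notin> X" "i \<in> I" "v \<in> support i" "support i \<subseteq> insert v X"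
    and growth: "\<And>U w. insert w U \<subseteq> X \<Longrightarrow> w \<notin> U \<Longrightarrow> 2 * card (good U) \<le> card (good (insert w U))"
  shows "2 ^ (card (A i) - 1) * card {f \<in> extensions v X. repeats f i} \<le> card (good X)"
proof -
  \<comment> \<open>\<open>R\<close> is the set to be erased.\<close>
  define R where "R = (if v \<in> A i then A i else \<sigma> i ` A i)"
  let ?Y = "X - R"
  have vR: "v \<in> R" and RX: "R \<subseteq> insert v X"
    using assms(4,5) by (auto simp: R_def support_def)
  have "card R = card (A i)"
    using card_image[OF inj[OF assms(3)]] by (simp add: R_def)
  moreover have "X - ?Y = R - {v}"
    using vR RX assms(2) by auto
  ultimately have card: "card (X - ?Y) = card (A i) - 1"
    using vR by (simp add: card_Diff_singleton)
  have "inj_on (\<lambda>f. restrict f ?Y) {f \<in> extensions v X. repeats f i}"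
  proof (rule inj_onI)
    fix f g
    assume f: "f \<in> {f \<in> extensions v X. repeats f i}" and g: "g \<in> {f \<in> extensions v X. repeats f i}"
      and eq: "restrict f ?Y = restrict g ?Y"
    have Y: "f x = g x" if "x \<in> insert v X" "x \<notin> R" for x
      using fun_cong[OF eq, of x] that vR by (auto split: if_splits)
    have R: "f x = g x" if "x \<in> R" for x
    proof (cases "v \<in> A i")
      case True
      with that have x: "x \<in> A i"
        using that by (simp add: R_def)
      then have "\<sigma> i x \<notin> R" "\<sigma> i x \<in> insert v X"
        using True disjoint[OF assms(3)] assms(5) by (auto simp: R_def support_def)
      then show ?thesis
        using Y[of "\<sigma> i x"] f g x by (simp add: repeats_def)
    next
      case False
      with that obtain a where x: "x = \<sigma> i a" "a \<in> A i"
        by (auto simp: R_def)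
      then have "a \<notin> R" "a \<in> insert v X"
        using False disjoint[OF assms(3)] assms(5) by (auto simp: R_def support_def)
      then show ?thesis
        using Y[of a] f g x by (simp add: repeats_def)
    qed
    show "f = g"
    proof (rule PiE_ext)
      show "f \<in> insert v X \<rightarrow>\<^sub>E {..<8}" "g \<in> insert v X \<rightarrow>\<^sub>E {..<8}"
        using f g by (simp_all add: extensions_def)
    qed (use Y R in blast)
  qed
  moreover have "(\<lambda>f. restrict f ?Y) ` {f \<in> extensions v X. repeats f i} \<subseteq> good ?Y"
  proof clarify
    fix f assume "f \<in> extensions v X"
    then have "restrict f X \<in> good X"
      by (simp add: extensions_def)
    then have "restrict (restrict f X) ?Y \<in> good ?Y"
      by (rule restrict_good) blast
    then show "restrict f ?Y \<in> good ?Y"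
      by (simp add: Int_absorb1)
  qed
  ultimately have "card {f \<in> extensions v X. repeats f i} \<le> card (good ?Y)"
    using assms(1) by (intro card_inj_on_le[of "\<lambda>f. restrict f ?Y"] finite_good) auto
  then have "2 ^ (card (A i) - 1) * card {f \<in> extensions v X. repeats f i} \<le>
      2 ^ card (X - ?Y) * card (good ?Y)"
    using card by simp
  also have "\<dots> \<le> card (good X)"
    by (rule good_growth_iterate) (use assms(1) growth in auto)
  finally show ?thesis .
qed

lemma sum_half_powers:
  assumes "1 \<le> K"
  shows "(\<Sum>k=2..K. real k / 2 ^ k) = 3/2 - (real K + 2) / 2 ^ K"
  using assms
proof (induction K rule: dec_induct)
  case (step K)
  have "(\<Sum>k=2..Suc K. real k / 2 ^ k) = 3/2 - (real K + 2) / 2 ^ K + real (Suc K) / 2 ^ Suc K"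
    using step by simp
  also have "\<dots> = 3/2 - (real (Suc K) + 2) / 2 ^ Suc K"
    by (simp add: field_simps)
  finally show ?case .
qed simp

lemma finite_constraints_at:
  assumes "finite X"
  shows "finite {i \<in> I. v \<in> support i \<and> support i \<subseteq> X}"
proof (rule finite_subset)
  show "{i \<in> I. v \<in> support i \<and> support i \<subseteq> X} \<subseteq>
    (\<Union>k\<le>card X. {i \<in> I. card (A i) = k \<and> v \<in> A i \<union> \<sigma> i ` A i})"
    using assms by (auto simp: support_def intro: card_mono)
qed (auto intro!: finite_degree[simplified])

text \<open>Group the constraints by window size \<open>k \<ge> 2\<close>: there are at most \<open>2 k\<close> of each size, and the
  sum of \<open>4 k / 2 ^ k\<close> over all \<open>k \<ge> 2\<close> is \<open>6\<close>.\<close>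

lemma constraint_weight_le:
  assumes "finite X"
  shows "(\<Sum>i\<in>{i \<in> I. v \<in> support i \<and> support i \<subseteq> X}. 2 / 2 ^ card (A i)) \<le> (6::real)"
proof (cases "X = {}")
  case False
  let ?J = "{i \<in> I. v \<in> support i \<and> support i \<subseteq> X}" and ?K = "card X"
  have K: "1 \<le> ?K"
    using False assms by (simp add: Suc_leI card_gt_0_iff)
  have "(\<Sum>i\<in>?J. 2 / 2 ^ card (A i)) = 
    (\<Sum>k=2..?K. \<Sum>i\<in>{i \<in> ?J. card (A i) = k}. 2 / 2 ^ card (A i) :: real)"
    by (rule sum.group[symmetric])
      (use assms finite_constraints_at card_ge_2 in \<open>auto simp: support_def intro: card_mono\<close>)
  also have "\<dots> \<le> (\<Sum>k=2..?K. 4 * (real k / 2 ^ k))"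
  proof (rule sum_mono)
    fix k
    have "card {i \<in> ?J. card (A i) = k} \<le> card {i \<in> I. card (A i) = k \<and> v \<in> A i \<union> \<sigma> i ` A i}"
      by (rule card_mono[OF finite_degree]) (auto simp: support_def)
    also have "\<dots> \<le> 2 * k"
      by (rule degree_le)
    finally have "real (card {i \<in> ?J. card (A i) = k}) \<le> 2 * real k"
      by linarith
    then have "real (card {i \<in> ?J. card (A i) = k}) * (2 / 2 ^ k) \<le> 2 * real k * (2 / 2 ^ k)"
      by (rule mult_right_mono) simp
    then show "(\<Sum>i\<in>{i \<in> ?J. card (A i) = k}. 2 / 2 ^ card (A i)) \<le> 4 * (real k / 2 ^ k)"
      by simp
  qed
  also have "\<dots> = 4 * (3/2 - (real ?K + 2) / 2 ^ ?K)"
    by (simp only: sum_distrib_left[symmetric] sum_half_powers[OF K])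
  also have "\<dots> \<le> 6"
    by simp
  finally show ?thesis .
next
  case True
  then have "{i \<in> I. v \<in> support i \<and> support i \<subseteq> X} = {}"
    by auto
  then show ?thesis
    by (simp only: sum.empty)
qed

text \<open>Of the \<open>8 * card (good X)\<close> extensions, those violating constraint \<open>i\<close> make up at most
  \<open>2 / 2 ^ card (A i)\<close> times \<open>card (good X)\<close>. In total at most \<open>6 * card (good X)\<close> of them are bad, and
  \<open>8 - 6\<close> is again the growth factor \<open>2\<close> used in the induction. This is what fixes the number of
  colors.\<close>

lemma good_growth:
  assumes "finite X" "v \<notin> X"
  shows "2 * card (good X) \<le> card (good (insert v X))"
  using assms
proof (induction "card X" arbitrary: X v rule: less_induct)
  case less
  let ?X = "insert v X"
  let ?J = "{i \<in> I. v \<in> support i \<and> support i \<subseteq> ?X}"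
  let ?B = "\<lambda>i. {f \<in> extensions v X. repeats f i}"
  have growth: "2 * card (good U) \<le> card (good (insert w U))" if "insert w U \<subseteq> X" "w \<notin> U" for U w
  proof (rule less.hyps)
    show "card U < card X"
      using that less.prems(1) by (intro psubset_card_mono) auto
    show "finite U"
      using that(1) by (intro finite_subset[OF _ less.prems(1)]) auto
    show "w \<notin> U" by (rule that(2))
  qed
  have finJ: "finite ?J"
    using less.prems(1) by (intro finite_constraints_at) simp
  have finE: "finite (extensions v X)"
    by (rule finite_subset[of _ "?X \<rightarrow>\<^sub>E {..<8}"])
      (use less.prems(1) in \<open>auto simp: extensions_def intro: finite_PiE\<close>)
  have B: "real (card (?B i)) \<le> real (card (good X)) * (2 / 2 ^ card (A i))" if "i \<in> ?J" for i
  proof -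
    have "2 ^ (card (A i) - 1) * card (?B i) \<le> card (good X)"
      by (rule card_repeating_extensions) (use that less.prems growth in auto)
    then have "real (2 ^ (card (A i) - 1) * card (?B i)) \<le> real (card (good X))"
      by (simp only: of_nat_le_iff)
    moreover have "(2::real) ^ card (A i) = 2 * 2 ^ (card (A i) - 1)"
      using card_ge_2[of i] that by (subst power_Suc[symmetric]) (simp add: Suc_diff_Suc)
    ultimately show ?thesis
      by (simp add: field_simps)
  qed
  have fin_union: "finite (good ?X \<union> (\<Union>i\<in>?J. ?B i))"
  proof (intro finite_UnI finite_UN_I finJ finite_good)
    show "finite ?X" using less.prems(1) by simp
    show "finite (?B i)" for i using finE by (rule rev_finite_subset) blast
  qed
  have cover: "extensions v X \<subseteq> good ?X \<union> (\<Union>i\<in>?J. ?B i)"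
  proof
    fix f assume f: "f \<in> extensions v X"
    have J: "i \<in> ?J" if i: "i \<in> I" "support i \<subseteq> ?X" "repeats f i" for i
    proof (rule ccontr)
      assume "i \<notin> ?J"
      then have sub: "support i \<subseteq> X"
        using i by auto
      then have "repeats (restrict f X) i \<longleftrightarrow> repeats f i"
        by (intro repeats_cong) auto
      then show False
        using f i(1,3) sub by (simp add: extensions_def good_def)
    qed
    show "f \<in> good ?X \<union> (\<Union>i\<in>?J. ?B i)"
    proof (cases "f \<in> good ?X")
      case False
      then obtain i where "i \<in> I" "support i \<subseteq> ?X" "repeats f i"
        using f by (auto simp only: good_def extensions_def mem_Collect_eq)
      then show ?thesis
        using J[of i] f by blast
    qed (rule UnI1)
  qed
  have "card (extensions v X) \<le> card (good ?X \<union> (\<Union>i\<in>?J. ?B i))"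
    by (rule card_mono[OF fin_union cover])
  also have "\<dots> \<le> card (good ?X) + (\<Sum>i\<in>?J. card (?B i))"
    using card_Un_le[of "good ?X" "\<Union>i\<in>?J. ?B i"] card_UN_le[OF finJ, of ?B] by linarith
  finally have "8 * card (good X) \<le> card (good ?X) + (\<Sum>i\<in>?J. card (?B i))"
    using card_extensions less.prems by simp
  then have "real (8 * card (good X)) \<le> real (card (good ?X) + (\<Sum>i\<in>?J. card (?B i)))"
    by (simp only: of_nat_le_iff)
  then have "8 * real (card (good X)) \<le> real (card (good ?X)) + (\<Sum>i\<in>?J. real (card (?B i)))"
    by simp
  also have "(\<Sum>i\<in>?J. real (card (?B i))) \<le> (\<Sum>i\<in>?J. real (card (good X)) * (2 / 2 ^ card (A i)))"
    by (rule sum_mono) (rule B)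
  also have "\<dots> = real (card (good X)) * (\<Sum>i\<in>?J. 2 / 2 ^ card (A i))"
    by (simp only: sum_distrib_left)
  also have "\<dots> \<le> real (card (good X)) * 6"
    by (intro mult_left_mono constraint_weight_le) (use less.prems in auto)
  finally show ?case
    by linarith
qed

lemma good_nonempty:
  assumes "finite X"
  shows "good X \<noteq> {}"
  using assms
proof (induction X rule: finite_induct)
  case empty
  have "\<not> support i \<subseteq> {}" if "i \<in> I" for i
    using card_ge_2[OF that] by (auto simp: support_def)
  then have "(\<lambda>x. undefined) \<in> good {}"
    by (auto simp: good_def)
  then show ?case by blast
next
  case (insert v X)
  then have "0 < card (good X)"
    by (simp add: card_gt_0_iff finite_good)
  then have "0 < card (good (insert v X))"
    using good_growth[OF insert.hyps(1,2)] by linarith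
  then show ?case by (simp add: card_gt_0_iff)
qed

text \<open>Avoiding one repetition is a closed condition on colorings, because it involves finitely many
  points; \<open>good_nonempty\<close> gives the finite intersection property.\<close>

theorem exists_coloring_without_repetitions:
  assumes V: "\<And>i. i \<in> I \<Longrightarrow> support i \<subseteq> V"
  shows "\<exists>f \<in> V \<rightarrow>\<^sub>E {..<8}. \<forall>i\<in>I. \<not> repeats f i"
proof (cases "I = {}")
  case True
  have "(\<lambda>x\<in>V. 0) \<in> V \<rightarrow>\<^sub>E {..<8::nat}"
    by auto
  with True show ?thesis by blast
next
  case False
  define T where "T = product_topology (\<lambda>_. discrete_topology {..<8::nat}) V"
  have top: "topspace T = V \<rightarrow>\<^sub>E {..<8}"
    by (simp add: T_def topspace_product_topology)
  define C where "C i = {f \<in> topspace T. \<not> repeats f i}" for i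
  have compact: "compact_space T"
    unfolding T_def compact_space_product_topology compact_space_discrete_topology by simp
  have closed: "closedin T (C i)" if i: "i \<in> I" for i
  proof -
    have "closedin T {f \<in> topspace T. f (\<sigma> i a) \<noteq> f a}" if a: "a \<in> A i" for a
    proof -
      have mem: "\<sigma> i a \<in> V" "a \<in> V"
        using V[OF i] a by (auto simp: support_def)
      let ?N = "{p \<in> {..<8::nat} \<times> {..<8}. fst p \<noteq> snd p}"
      have "continuous_map T (discrete_topology ({..<8} \<times> {..<8})) (\<lambda>f. (f (\<sigma> i a), f a))"
        unfolding prod_topology_discrete_topology T_def
        by (intro continuous_map_pairedI continuous_map_product_projection mem)
      moreover have "closedin (discrete_topology ({..<8} \<times> {..<8})) ?N"
        unfolding closedin_discrete_topology by blast
      ultimately have "closedin T {f \<in> topspace T. (f (\<sigma> i a), f a) \<in> ?N}"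
        by (rule closedin_continuous_map_preimage)
      also have "{f \<in> topspace T. (f (\<sigma> i a), f a) \<in> ?N} =
          {f \<in> topspace T. f (\<sigma> i a) \<noteq> f a}"
        using mem by (auto simp: top)
      finally show ?thesis .
    qed
    then have "closedin T (\<Union>a\<in>A i. {f \<in> topspace T. f (\<sigma> i a) \<noteq> f a})"
      using finite_A[OF i] by (intro closedin_Union) blast+
    also have "(\<Union>a\<in>A i. {f \<in> topspace T. f (\<sigma> i a) \<noteq> f a}) = C i"
      by (auto simp: C_def repeats_def)
    finally show ?thesis .
  qed
  have fip: "\<Inter>\<F> \<noteq> {}" if \<F>: "finite \<F>" "\<F> \<subseteq> C ` I" for \<F>
  proof -
    obtain J where J: "finite J" "J \<subseteq> I" "\<F> = C ` J"
      using finite_subset_image[OF \<F>] by blast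
    let ?X = "\<Union>i\<in>J. support i"
    have "finite ?X"
      using J finite_A by (auto simp: support_def)
    then obtain f where f: "f \<in> good ?X"
      using good_nonempty by blast
    define g where "g = (\<lambda>x\<in>V. if x \<in> ?X then f x else 0)"
    have "g \<in> C i" if i: "i \<in> J" for i
    proof -
      have "repeats g i \<longleftrightarrow> repeats f i"
        by (rule repeats_cong) (use i V J in \<open>auto simp: g_def\<close>)
      moreover have "\<not> repeats f i"
        using f i J by (auto simp: good_def)
      moreover have "g \<in> topspace T"
        using f by (auto simp: top g_def good_def PiE_def Pi_def)
      ultimately show ?thesis
        by (simp add: C_def)
    qed
    then show ?thesis
      unfolding J(3) by blast
  qed
  have "\<forall>D\<in>C ` I. closedin T D"
    using closed by blast
  with compact fip have "\<Inter>(C ` I) \<noteq> {}"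
    unfolding compact_space_fip by (elim allE[of _ "C ` I"] impE) simp_all
  then show ?thesis
    using False by (auto simp: C_def top)
qed

end

section \<open>Limit aperiodic colorings of countable groups\<close>

text \<open>The window \<open>T\<close> does not depend on \<open>h\<close>; this uniformity is what survives in the orbit
  closure.\<close>

definition blocks :: "('a, 'b) monoid_scheme \<Rightarrow> ('a \<Rightarrow> 'c) \<Rightarrow> 'a \<Rightarrow> bool" where
  "blocks G \<phi> s \<longleftrightarrow> (\<exists>T. finite T \<and> T \<subseteq> carrier G \<and>
    (\<forall>h\<in>carrier G. \<exists>t\<in>T. \<phi> (h \<otimes>\<^bsub>G\<^esub> (s \<otimes>\<^bsub>G\<^esub> t)) \<noteq> \<phi> (h \<otimes>\<^bsub>G\<^esub> t)))"

lemma coloring_space_closure_approx: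
  assumes "\<psi> \<in> coloring_space G F closure_of Orb" "finite S" "S \<subseteq> carrier G"
  shows "\<exists>\<chi>\<in>Orb. \<forall>x\<in>S. \<chi> x = \<psi> x"
proof -
  have \<psi>: "\<psi> \<in> carrier G \<rightarrow>\<^sub>E F"
    using assms(1) by (auto simp: in_closure_of coloring_space_def topspace_product_topology)
  define U where "U = (\<Pi>\<^sub>E x\<in>carrier G. if x \<in> S then {\<psi> x} else F)"
  have "openin (coloring_space G F) U"
    unfolding coloring_space_def U_def
  proof (rule product_topology_basis)
    show "openin (discrete_topology F) (if x \<in> S then {\<psi> x} else F)" for x
      using \<psi> assms(3) by auto
    show "finite {x. (if x \<in> S then {\<psi> x} else F) \<noteq> topspace (discrete_topology F)}"
      by (rule finite_subset[OF _ assms(2)]) auto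
  qed
  moreover have "\<psi> \<in> U"
    using \<psi> by (auto simp: U_def PiE_def Pi_def)
  ultimately obtain \<chi> where \<chi>: "\<chi> \<in> Orb" "\<chi> \<in> U"
    using assms(1) unfolding in_closure_of by blast
  have "\<chi> x = \<psi> x" if "x \<in> S" for x
    using PiE_mem[OF \<chi>(2)[unfolded U_def], of x] that assms(3) by auto
  with \<chi>(1) show ?thesis by blast
qed

text \<open>If \<open>g\<close> fixes \<open>\<psi>\<close>, then \<open>\<psi> (inv g \<otimes> t) = \<psi> t\<close> for all \<open>t\<close>. Some translate \<open>k \<phi>\<close> agrees with
  \<open>\<psi>\<close> on the finite window for \<open>inv g\<close> and its shift, which contradicts blocking at the
  position \<open>inv k\<close>.\<close>

lemma (in group) limit_aperiodic_if_blocks: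
  assumes "\<And>s. s \<in> carrier G \<Longrightarrow> s \<noteq> \<one> \<Longrightarrow> blocks G \<phi> s"
  shows "limit_aperiodic G F \<phi>"
  unfolding limit_aperiodic_def aperiodic_def
proof (intro ballI notI)
  fix \<psi> g
  assume \<psi>: "\<psi> \<in> coloring_space G F closure_of ((\<lambda>g. coloring_action G g \<phi>) ` carrier G)"
    and g: "g \<in> carrier G - {\<one>}" and fix_eq: "coloring_action G g \<psi> = \<psi>"
  let ?s = "inv g"
  have s: "?s \<in> carrier G" "?s \<noteq> \<one>"
    using g by auto
  obtain T where T: "finite T" "T \<subseteq> carrier G"
    and block: "\<And>h. h \<in> carrier G \<Longrightarrow> \<exists>t\<in>T. \<phi> (h \<otimes> (?s \<otimes> t)) \<noteq> \<phi> (h \<otimes> t)"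
    using assms[OF s] unfolding blocks_def by blast
  obtain k where k: "k \<in> carrier G"
    and agree: "\<And>x. x \<in> T \<union> (\<lambda>t. ?s \<otimes> t) ` T \<Longrightarrow> coloring_action G k \<phi> x = \<psi> x"
    using coloring_space_closure_approx[OF \<psi>, of "T \<union> (\<lambda>t. ?s \<otimes> t) ` T"] T s(1) by blast
  obtain t where t: "t \<in> T" "\<phi> (inv k \<otimes> (?s \<otimes> t)) \<noteq> \<phi> (inv k \<otimes> t)"
    using block[of "inv k"] k by auto
  have tG: "t \<in> carrier G"
    using t(1) T(2) by auto
  have "\<phi> (inv k \<otimes> (?s \<otimes> t)) = \<psi> (?s \<otimes> t)"
    using agree[of "?s \<otimes> t"] t(1) tG s(1) by (simp add: coloring_action_def)
  also have "\<dots> = \<psi> t"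
    using fun_cong[OF fix_eq, of t] tG by (simp add: coloring_action_def)
  also have "\<dots> = \<phi> (inv k \<otimes> t)"
    using agree[of t] t(1) tG by (simp add: coloring_action_def)
  finally show False
    using t(2) by contradiction
qed

text \<open>Greedy choice: a new element has to avoid \<open>T\<close>, \<open>s T\<close> and \<open>inv s T\<close>, and these are finite.\<close>

lemma (in group) exists_set_disjoint_from_translate:
  assumes "infinite (carrier G)" "s \<in> carrier G" "s \<noteq> \<one>"
  shows "\<exists>T \<subseteq> carrier G. finite T \<and> card T = n \<and> T \<inter> (\<lambda>t. s \<otimes> t) ` T = {}"
proof (induction n)
  case 0
  then show ?case by (intro exI[of _ "{}"]) auto
next
  case (Suc n)
  then obtain T where T: "T \<subseteq> carrier G" "finite T" "card T = n" "T \<inter> (\<lambda>t. s \<otimes> t) ` T = {}"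
    by blast
  have "finite (T \<union> (\<lambda>t. s \<otimes> t) ` T \<union> (\<lambda>t. inv s \<otimes> t) ` T)"
    using T by simp
  then obtain x where x: "x \<in> carrier G" "x \<notin> T" "x \<notin> (\<lambda>t. s \<otimes> t) ` T" "x \<notin> (\<lambda>t. inv s \<otimes> t) ` T"
    using assms(1) by (meson UnCI finite_subset subsetI)
  have "s \<otimes> x \<noteq> x"
    using assms x(1) by (simp add: r_cancel_one)
  moreover have "s \<otimes> x \<notin> T"
  proof
    assume "s \<otimes> x \<in> T"
    then have "inv s \<otimes> (s \<otimes> x) \<in> (\<lambda>t. inv s \<otimes> t) ` T" by blast
    then show False
      using x assms(2) by (simp add: inv_solve_left' m_assoc[symmetric])
  qed
  ultimately have "insert x T \<inter> (\<lambda>t. s \<otimes> t) ` insert x T = {}"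
    using T(4) x(3) by auto
  then show ?case
    using T x by (intro exI[of _ "insert x T"]) auto
qed

lemma (in group) exists_blocking_coloring_infinite:
  assumes "countable (carrier G)" "infinite (carrier G)"
  shows "\<exists>\<phi> \<in> carrier G \<rightarrow>\<^sub>E {..<8::nat}. \<forall>s\<in>carrier G. s \<noteq> \<one> \<longrightarrow> blocks G \<phi> s"
proof -
  define e where "e = to_nat_on (carrier G)"
  have e: "inj_on e (carrier G)"
    unfolding e_def using assms(1) by (rule inj_on_to_nat_on)
  \<comment> \<open>The constraint \<open>(s, h)\<close> lives on the translates of \<open>T s\<close> and \<open>s T s\<close> by \<open>h\<close>. Since \<open>e\<close> is
    injective, the window size \<open>e s + 2\<close> determines \<open>s\<close>.\<close>
  define I where "I = (carrier G - {\<one>}) \<times> carrier G"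
  have "\<exists>T \<subseteq> carrier G. finite T \<and> card T = e s + 2 \<and> T \<inter> (\<lambda>t. s \<otimes> t) ` T = {}"
    if "s \<in> carrier G - {\<one>}" for s
    using exists_set_disjoint_from_translate[OF assms(2)] that by blast
  then obtain T where T: "\<And>s. s \<in> carrier G - {\<one>} \<Longrightarrow> T s \<subseteq> carrier G \<and> finite (T s) \<and>
      card (T s) = e s + 2 \<and> T s \<inter> (\<lambda>t. s \<otimes> t) ` T s = {}"
    by metis
  define A where "A = (\<lambda>(s, h). (\<lambda>t. h \<otimes> t) ` T s)"
  define \<sigma> where "\<sigma> = (\<lambda>(s, h) x. h \<otimes> (s \<otimes> (inv h \<otimes> x)))"
  have \<sigma>: "\<sigma> (s, h) (h \<otimes> t) = h \<otimes> (s \<otimes> t)"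
    if "h \<in> carrier G" "t \<in> carrier G" for s h t
    using that by (simp add: \<sigma>_def m_assoc[symmetric])
  have \<sigma>_image: "\<sigma> (s, h) ` A (s, h) = (\<lambda>t. h \<otimes> (s \<otimes> t)) ` T s" if "(s, h) \<in> I" for s h
  proof -
    have "\<sigma> (s, h) (h \<otimes> t) = h \<otimes> (s \<otimes> t)" if "t \<in> T s" for t
      using \<sigma>[of h t s] T[of s] \<open>(s, h) \<in> I\<close> that by (auto simp: I_def)
    then show ?thesis
      by (simp add: A_def image_image)
  qed
  have card_A: "card (A (s, h)) = e s + 2" if "(s, h) \<in> I" for s h
  proof -
    have "inj_on (\<lambda>t. h \<otimes> t) (T s)"
      using that T[of s] by (auto simp: I_def subset_iff intro!: inj_onI)
    then show ?thesis
      using that T[of s] by (simp add: A_def card_image I_def)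
  qed
  \<comment> \<open>A constraint \<open>(s, h)\<close> with \<open>v\<close> in its support is determined by \<open>t \<in> T s\<close> and by whether
    \<open>v = h t\<close> or \<open>v = h s t\<close>, which gives at most \<open>2 * card (T s)\<close> values of \<open>h\<close>.\<close>
  have degree: "\<exists>D. finite D \<and> card D \<le> 2 * k \<and>
      {i \<in> I. card (A i) = k \<and> v \<in> A i \<union> \<sigma> i ` A i} \<subseteq> D" for k v
  proof (cases "\<exists>s\<in>carrier G - {\<one>}. e s + 2 = k")
    case False
    then have "{i \<in> I. card (A i) = k \<and> v \<in> A i \<union> \<sigma> i ` A i} = {}"
      using card_A by (fastforce simp: I_def)
    then show ?thesis
      by (intro exI[of _ "{}"]) simp
  next
    case True
    then obtain s where s: "s \<in> carrier G - {\<one>}" "e s + 2 = k" by blast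
    let ?D1 = "(\<lambda>t. (s, v \<otimes> inv t)) ` T s" and ?D2 = "(\<lambda>t. (s, v \<otimes> inv (s \<otimes> t))) ` T s"
    have "card (?D1 \<union> ?D2) \<le> card (T s) + card (T s)"
      using card_Un_le[of ?D1 ?D2] card_image_le[of "T s"] T[OF s(1)]
      by (meson add_mono order_trans)
    then have "card (?D1 \<union> ?D2) \<le> 2 * k"
      using T[OF s(1)] s(2) by simp
    moreover have "{i \<in> I. card (A i) = k \<and> v \<in> A i \<union> \<sigma> i ` A i} \<subseteq> ?D1 \<union> ?D2"
    proof clarify
      fix s' h
      assume i: "(s', h) \<in> I" "k = card (A (s', h))" "(s', h) \<notin> ?D2"
        and v: "v \<in> A (s', h) \<union> \<sigma> (s', h) ` A (s', h)"
      have h: "h \<in> carrier G"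
        using i(1) by (simp add: I_def)
      have "e s' = e s"
        using card_A[OF i(1)] i(2) s(2) by simp
      then have s': "s' = s"
        using e i(1) s(1) by (auto simp: I_def dest: inj_onD)
      have "v \<in> (\<lambda>t. h \<otimes> t) ` T s \<or> v \<in> (\<lambda>t. h \<otimes> (s \<otimes> t)) ` T s"
        using v \<sigma>_image[OF i(1)] by (auto simp: A_def s')
      then show "(s', h) \<in> ?D1"
      proof (elim disjE imageE)
        fix t assume t: "v = h \<otimes> t" "t \<in> T s"
        then have "v \<otimes> inv t = h"
          using h T[OF s(1)] by (auto simp: m_assoc)
        then show ?thesis
          using t(2) s' by force
      next
        fix t assume t: "v = h \<otimes> (s \<otimes> t)" "t \<in> T s"
        moreover have "s \<otimes> t \<in> carrier G"
          using t(2) T[OF s(1)] s(1) by auto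
        ultimately have "v \<otimes> inv (s \<otimes> t) = h"
          using h by (simp only: m_assoc inv_closed r_inv r_one)
        then have "(s', h) \<in> ?D2"
          using t(2) s' by force
        with i(3) show ?thesis by contradiction
      qed
    qed
    ultimately show ?thesis
      using T[OF s(1)] by (intro exI[of _ "?D1 \<union> ?D2"]) auto
  qed
  interpret repetition_system I A \<sigma>
  proof
    fix i assume i: "i \<in> I"
    obtain s h where sh: "i = (s, h)" by force
    have h: "h \<in> carrier G" and s: "s \<in> carrier G - {\<one>}"
      using i sh by (auto simp: I_def)
    note Ts = T[OF s]
    show "2 \<le> card (A i)"
      using card_A i sh by simp
    show "inj_on (\<sigma> i) (A i)"
    proof (rule inj_onI)
      fix x y assume "x \<in> A i" "y \<in> A i" "\<sigma> i x = \<sigma> i y"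
      then show "x = y"
        using h s Ts by (auto simp: A_def sh \<sigma> subset_iff)
    qed
    have "h \<otimes> t \<noteq> h \<otimes> (s \<otimes> u)" if "t \<in> T s" "u \<in> T s" for t u
    proof
      assume "h \<otimes> t = h \<otimes> (s \<otimes> u)"
      then have "t = s \<otimes> u"
        using h s Ts that by (auto simp: subset_iff)
      then show False
        using Ts that by blast
    qed
    then show "A i \<inter> \<sigma> i ` A i = {}"
      using \<sigma>_image[of s h] i by (auto simp: A_def sh)
  next
    fix k v
    obtain D where D: "finite D" "card D \<le> 2 * k"
        "{i \<in> I. card (A i) = k \<and> v \<in> A i \<union> \<sigma> i ` A i} \<subseteq> D"
      using degree[of k v] by (elim exE conjE)
    show "finite {i \<in> I. card (A i) = k \<and> v \<in> A i \<union> \<sigma> i ` A i}"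
      using D(3,1) by (rule finite_subset)
    show "card {i \<in> I. card (A i) = k \<and> v \<in> A i \<union> \<sigma> i ` A i} \<le> 2 * k"
      using card_mono[OF D(1,3)] D(2) by (rule le_trans)
  qed
  have "support i \<subseteq> carrier G" if "i \<in> I" for i
  proof -
    obtain s h where sh: "i = (s, h)" by force
    have mem: "h \<in> carrier G" "s \<in> carrier G" "T s \<subseteq> carrier G"
      using that sh T[of s] by (auto simp: I_def)
    have "A i = (\<lambda>t. h \<otimes> t) ` T s"
      by (simp add: A_def sh)
    moreover have "\<sigma> i ` A i = (\<lambda>t. h \<otimes> (s \<otimes> t)) ` T s"
      using \<sigma>_image[of s h] that by (simp only: sh)
    ultimately have "support i = (\<lambda>t. h \<otimes> t) ` T s \<union> (\<lambda>t. h \<otimes> (s \<otimes> t)) ` T s"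
      by (simp only: support_def)
    moreover have "(\<lambda>t. h \<otimes> t) ` T s \<union> (\<lambda>t. h \<otimes> (s \<otimes> t)) ` T s \<subseteq> carrier G"
      using mem by auto
    ultimately show ?thesis by simp
  qed
  from exists_coloring_without_repetitions[OF this]
  obtain \<phi> where \<phi>: "\<phi> \<in> carrier G \<rightarrow>\<^sub>E {..<8}" "\<And>i. i \<in> I \<Longrightarrow> \<not> repeats \<phi> i"
    by blast
  have "blocks G \<phi> s" if s: "s \<in> carrier G" "s \<noteq> \<one>" for s
    unfolding blocks_def
  proof (intro exI[of _ "T s"] conjI ballI)
    have Ts: "T s \<subseteq> carrier G" "finite (T s)"
      using T[of s] s by auto
    then show "finite (T s)" "T s \<subseteq> carrier G" by auto
    fix h assume h: "h \<in> carrier G"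
    then have "\<not> repeats \<phi> (s, h)"
      using s by (intro \<phi>(2)) (simp add: I_def)
    then obtain x where "x \<in> A (s, h)" "\<phi> (\<sigma> (s, h) x) \<noteq> \<phi> x"
      unfolding repeats_def by blast
    then obtain t where t: "t \<in> T s" "\<phi> (\<sigma> (s, h) (h \<otimes> t)) \<noteq> \<phi> (h \<otimes> t)"
      unfolding A_def prod.case by blast
    then have "\<phi> (h \<otimes> (s \<otimes> t)) \<noteq> \<phi> (h \<otimes> t)"
      using \<sigma>[OF h, of t s] Ts(1) by auto
    with t(1) show "\<exists>t\<in>T s. \<phi> (h \<otimes> (s \<otimes> t)) \<noteq> \<phi> (h \<otimes> t)" ..
  qed
  with \<phi>(1) show ?thesis by blast
qed

lemma (in group) blocks_if_inj_on:
  assumes "inj_on \<phi> (carrier G)" "s \<in> carrier G" "s \<noteq> \<one>"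
  shows "blocks G \<phi> s"
  unfolding blocks_def
proof (intro exI[of _ "{\<one>}"] conjI ballI)
  fix h assume h: "h \<in> carrier G"
  then have "h \<otimes> s \<noteq> h"
    using assms(2,3) by (simp add: l_cancel_one)
  then show "\<exists>t\<in>{\<one>}. \<phi> (h \<otimes> (s \<otimes> t)) \<noteq> \<phi> (h \<otimes> t)"
    using h assms by (auto dest: inj_onD)
qed auto

theorem (in group) countable_group_limit_aperiodic:
  assumes "countable (carrier G)"
  shows "\<exists>(F :: nat set) \<phi>. finite F \<and> \<phi> \<in> carrier G \<rightarrow>\<^sub>E F \<and> limit_aperiodic G F \<phi>"
proof (cases "finite (carrier G)")
  case True
  define \<phi> where "\<phi> = restrict (to_nat_on (carrier G)) (carrier G)"
  have "inj_on \<phi> (carrier G)"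
    unfolding \<phi>_def inj_on_restrict_eq using assms by (rule inj_on_to_nat_on)
  then have "limit_aperiodic G (\<phi> ` carrier G) \<phi>"
    by (intro limit_aperiodic_if_blocks blocks_if_inj_on)
  moreover have "\<phi> \<in> carrier G \<rightarrow>\<^sub>E \<phi> ` carrier G"
    by (auto simp: \<phi>_def)
  ultimately show ?thesis
    using True by blast
next
  case False
  then obtain \<phi> where "\<phi> \<in> carrier G \<rightarrow>\<^sub>E {..<8::nat}" "\<And>s. s \<in> carrier G \<Longrightarrow> s \<noteq> \<one> \<Longrightarrow> blocks G \<phi> s"
    using exists_blocking_coloring_infinite[OF assms] by blast
  then show ?thesis
    using limit_aperiodic_if_blocks by blast
qed

section \<open>Coxeter groups\<close>

lemma countable_coxeter_group:
  assumes "coxeter_group G"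
  shows "countable (carrier G)"
proof -
  obtain k M where "G \<cong> presented_group {..<k} (coxeter_relators k M)"
    using assms by (auto simp: coxeter_group_def)
  then obtain f where "bij_betw f (carrier G) (carrier (presented_group {..<k} (coxeter_relators k M)))"
    by (auto simp: is_iso_def iso_def)
  moreover have "countable (carrier (presented_group {..<k} (coxeter_relators k M)))"
    by (simp add: presented_group_def quotient_def)
  ultimately show ?thesis
    by (metis bij_betw_def countable_image_inj_on)
qed

theorem theorem4:
  fixes G :: "('a, 'b) monoid_scheme"
  assumes "coxeter_group G"
  shows "\<exists>(F :: nat set) \<phi>. finite F \<and> \<phi> \<in> carrier G \<rightarrow>\<^sub>E F \<and> limit_aperiodic G F \<phi>"
proof -
  interpret group G
    using assms by (simp add: coxeter_group_def)
  show ?thesis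
    using countable_group_limit_aperiodic[OF countable_coxeter_group[OF assms]] .
qed

end
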